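(* Let $\beta_1,\dots,\beta_4>0$ be $$\beta_1=\sqrt{\mu_s}\,\mu,\quad \beta_2=\frac{\sqrt{\mu_s}\,L}{\sqrt{\mu}},\quad \beta_3=\frac{13\sqrt{\mu}}{16},\quad \beta_4=\frac{4\mu^2\sqrt{s}+3L\sqrt{\mu}\sqrt{\mu_s}}{8L^2},$$ and define $$a_1^*=\frac{2}{\beta_2^2}\Big(\beta_1\beta_4+\sqrt{\beta_2^2\beta_3\beta_4+\beta_1^2\beta_4^2}\Big).$$ Then, for every $0\le a\le a_1^*$, one has $\dot V\le -\frac{\sqrt{\mu}}{4}V$ along the dynamics $\dot p=X^a_{\mathrm{hb}}(p)$, that is, $\langle\nabla V(p),X^a_{\mathrm{hb}}(p)\rangle\le-\frac{\sqrt\mu}{4}V(p)$ for all $p\in\mathbb{R}^n\times\mathbb{R}^n$; as a consequence, $p_*=[x_*,0]^T$ is globally asymptotically stable for $\dot p=X^a_{\mathrm{hb}}(p)$. Moreover, if $s\le 1/L$, then along every trajectory $(x(t),v(t))$ of $\dot p=X^a_{\mathrm{hb}}(p)$ with initial condition $x(0)=x_0\in\mathbb{R}^n$, $v(0)=-\frac{2\sqrt{s}\,\nabla f(x_0)}{1+\sqrt{\mu s}}$, one has for all $t\ge 0$ $$f(x(t))-f(x_* )\le\frac{7\|x(0)-x_*\|^2}{2s}e^{-\frac{\sqrt{\mu}}{4}t}.$$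
   Context: Let $\mu,L,s>0$, and let $f:\mathbb{R}^n\to\mathbb{R}$ be continuously differentiable, $\mu$-strongly convex (i.e. $f(y)-f(x)\ge\langle\nabla f(x),y-x\rangle+\frac{\mu}{2}\|x-y\|^2$ for all $x,y$), with $L$-Lipschitz gradient; $x_*$ is its unique minimizer. Norms are Euclidean. Notation: $\sqrt{\mu_s}=1+\sqrt{\mu s}$, so $\mu_s=(1+\sqrt{\mu s})^2$; $p=[x,v]^T\in\mathbb{R}^n\times\mathbb{R}^n$. The heavy-ball dynamics with displaced gradient, with parameter $a\ge0$, is $\dot p=X^a_{\mathrm{hb}}(p)$ with $$X^a_{\mathrm{hb}}(x,v)=\begin{bmatrix} v\\ -2\sqrt{\mu}\,v-\sqrt{\mu_s}\,\nabla f(x+av)\end{bmatrix}.$$ The function $V$ is $$V(x,v)=\sqrt{\mu_s}\,(f(x)-f(x_* ))+\tfrac14\|v\|^2+\tfrac14\|v+2\sqrt{\mu}(x-x_* )\|^2 .$$ *)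

theory Defs
  imports "HOL-Analysis.Analysis"
begin

definition grad :: "('a::real_inner \<Rightarrow> real) \<Rightarrow> 'a \<Rightarrow> 'a" where
  "grad f x = (THE D. GDERIV f x :> D)"

text \<open>
  Strong convexity in first-order form; meant for differentiable functions, since
  \<open>grad f\<close> is unspecified elsewhere.
\<close>
definition strongly_convex :: "real \<Rightarrow> ('a::real_inner \<Rightarrow> real) \<Rightarrow> bool" where
  "strongly_convex \<mu> f \<longleftrightarrow>
    (\<forall>x y. f y - f x \<ge> grad f x \<bullet> (y - x) + \<mu> / 2 * (norm (x - y))\<^sup>2)"

definition trajectory :: "('a::real_normed_vector \<Rightarrow> 'a) \<Rightarrow> (real \<Rightarrow> 'a) \<Rightarrow> bool" where
  "trajectory X p \<longleftrightarrow>
    (\<forall>t\<ge>0. (p has_vector_derivative X (p t)) (at t within {0..}))"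

text \<open>
  The second conjunct (a forward trajectory on \<open>[0, \<infinity>)\<close> from every initial state) is usually
  tacit in textbook definitions; without it the two clauses quantifying over trajectories could
  hold vacuously.
\<close>
definition globally_asymptotically_stable ::
    "('a::real_normed_vector \<Rightarrow> 'a) \<Rightarrow> 'a \<Rightarrow> bool" where
  "globally_asymptotically_stable X q \<longleftrightarrow>
    X q = 0 \<and>
    (\<forall>p0. \<exists>p. trajectory X p \<and> p 0 = p0) \<and>
    (\<forall>\<epsilon>>0. \<exists>\<delta>>0. \<forall>p. trajectory X p \<longrightarrow> dist (p 0) q < \<delta> \<longrightarrow> (\<forall>t\<ge>0. dist (p t) q < \<epsilon>)) \<and>
    (\<forall>p. trajectory X p \<longrightarrow> (p \<longlongrightarrow> q) at_top)"

text \<open>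
  The quantity written \<open>\<surd>\<mu>\<^sub>s\<close>, where \<open>\<mu>\<^sub>s = (1 + \<surd>(\<mu> s))\<^sup>2\<close>.
\<close>
definition sqrt_mu_s :: "real \<Rightarrow> real \<Rightarrow> real" where
  "sqrt_mu_s \<mu> s = 1 + sqrt (\<mu> * s)"

definition X_hb :: "real \<Rightarrow> real \<Rightarrow> ('a::real_inner \<Rightarrow> real) \<Rightarrow> real \<Rightarrow> 'a \<times> 'a \<Rightarrow> 'a \<times> 'a" where
  "X_hb \<mu> s f a = (\<lambda>(x, v).
    (v, - (2 * sqrt \<mu>) *\<^sub>R v - sqrt_mu_s \<mu> s *\<^sub>R grad f (x + a *\<^sub>R v)))"

definition V_hb :: "real \<Rightarrow> real \<Rightarrow> ('a::real_inner \<Rightarrow> real) \<Rightarrow> 'a \<Rightarrow> 'a \<times> 'a \<Rightarrow> real" where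
  "V_hb \<mu> s f xs = (\<lambda>(x, v).
    sqrt_mu_s \<mu> s * (f x - f xs) + 1 / 4 * (norm v)\<^sup>2
      + 1 / 4 * (norm (v + (2 * sqrt \<mu>) *\<^sub>R (x - xs)))\<^sup>2)"

definition \<beta>1 :: "real \<Rightarrow> real \<Rightarrow> real" where
  "\<beta>1 \<mu> s = sqrt_mu_s \<mu> s * \<mu>"

definition \<beta>2 :: "real \<Rightarrow> real \<Rightarrow> real \<Rightarrow> real" where
  "\<beta>2 \<mu> L s = sqrt_mu_s \<mu> s * L / sqrt \<mu>"

definition \<beta>3 :: "real \<Rightarrow> real" where
  "\<beta>3 \<mu> = 13 * sqrt \<mu> / 16"

definition \<beta>4 :: "real \<Rightarrow> real \<Rightarrow> real \<Rightarrow> real" where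
  "\<beta>4 \<mu> L s = (4 * \<mu>\<^sup>2 * sqrt s + 3 * L * sqrt \<mu> * sqrt_mu_s \<mu> s) / (8 * L\<^sup>2)"

definition a1_star :: "real \<Rightarrow> real \<Rightarrow> real \<Rightarrow> real" where
  "a1_star \<mu> L s = 2 / (\<beta>2 \<mu> L s)\<^sup>2 *
    (\<beta>1 \<mu> s * \<beta>4 \<mu> L s
      + sqrt ((\<beta>2 \<mu> L s)\<^sup>2 * \<beta>3 \<mu> * \<beta>4 \<mu> L s + (\<beta>1 \<mu> s)\<^sup>2 * (\<beta>4 \<mu> L s)\<^sup>2))"

end

(*
  With e = x - xs, g = grad f x and the displaced gradient g' = grad f (x + a v),
  the derivative of V along the dynamics equals
    - sqrt mu |v|^2 - sqrt mu_s <g' - g, v> - sqrt mu_s sqrt mu <e, g'>.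
  Strong convexity and Lipschitz continuity of the gradient bound its sum with (sqrt mu / 4) V by
    - (beta3 + a beta1) |v|^2 + a beta2 |v| |g| - beta4 |g|^2,
  and a1_star is the positive root in a of the discriminant of this quadratic form in (|v|, |g|).
  Since V is comparable to the squared distance from the equilibrium, its exponential decay gives
  global asymptotic stability; trajectories exist for all times because the field is Lipschitz.
*)
theory Submission
  imports Defs
begin

section \<open>Gradients\<close>

text \<open>Riesz representation: \<open>f'\<close> is pairing with the vector
  \<open>adjoint f' 1\<close>, so a gradient exists; uniqueness of derivatives makes it the only
  one, as the definite description in \<open>grad\<close> requires.\<close>

lemma GDERIV_grad:
  fixes f :: "'a::euclidean_space \<Rightarrow> real"
  assumes "f differentiable (at x)"
  shows "GDERIV f x :> grad f x"
proof -
  from assms obtain f' where f': "(f has_derivative f') (at x)"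
    by (auto simp: differentiable_def)
  then have "linear f'"
    by (rule has_derivative_linear)
  then have "f' = (\<lambda>h. h \<bullet> adjoint f' 1)"
    by (simp add: fun_eq_iff adjoint_works)
  with f' have ex: "GDERIV f x :> adjoint f' 1"
    by (simp add: gderiv_def)
  have "D = D'" if "GDERIV f x :> D" "GDERIV f x :> D'" for D D'
    using has_derivative_unique[OF that[unfolded gderiv_def]]
    by (metis vector_eq_ldot)
  then show ?thesis
    unfolding grad_def using ex by (metis (mono_tags, lifting) theI)
qed

lemma grad_eqI:
  fixes f :: "'a::euclidean_space \<Rightarrow> real"
  assumes "GDERIV f x :> D"
  shows "grad f x = D"
proof -
  have "GDERIV f x :> grad f x"
    using assms by (intro GDERIV_grad) (auto simp: gderiv_def differentiable_def)
  then show ?thesis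
    using has_derivative_unique[OF assms[unfolded gderiv_def]] unfolding gderiv_def
    by (metis vector_eq_ldot)
qed

lemma GDERIV_along_line:
  assumes "GDERIV f (x + t *\<^sub>R d) :> D"
  shows "((\<lambda>t. f (x + t *\<^sub>R d)) has_real_derivative d \<bullet> D) (at t)"
proof -
  have "((\<lambda>t. x + t *\<^sub>R d) has_derivative (\<lambda>h. h *\<^sub>R d)) (at t)"
    by (auto intro!: derivative_eq_intros)
  from has_derivative_compose[OF this assms[unfolded gderiv_def]]
  show ?thesis
    by (simp add: has_field_derivative_def mult_commute_abs)
qed

text \<open>Along the segment, \<open>h\<close> is f minus its quadratic upper model. Its slope is
  nonpositive on [0, 1], because by the Lipschitz bound the gradient changes by at most L t |d| up
  to parameter t.\<close>

lemma descent_lemma: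
  fixes f :: "'a::euclidean_space \<Rightarrow> real"
  assumes diff: "\<And>x. f differentiable (at x)"
    and lip: "L-lipschitz_on UNIV (grad f)"
  shows "f y \<le> f x + grad f x \<bullet> (y - x) + L / 2 * (norm (y - x))\<^sup>2"
proof -
  define d where "d = y - x"
  define h where "h t = f (x + t *\<^sub>R d) - t * (grad f x \<bullet> d) - L / 2 * t\<^sup>2 * (norm d)\<^sup>2" for t
  have h': "(h has_real_derivative d \<bullet> grad f (x + t *\<^sub>R d) - grad f x \<bullet> d - L * t * (norm d)\<^sup>2) (at t)" for t
    unfolding h_def
    by (rule derivative_eq_intros GDERIV_along_line GDERIV_grad diff refl | simp)+
  have "h 1 \<le> h 0"
  proof (rule DERIV_nonpos_imp_nonincreasing[of 0 1 h])
    fix t :: real assume t: "0 \<le> t" "t \<le> 1"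
    have "d \<bullet> grad f (x + t *\<^sub>R d) - grad f x \<bullet> d = (grad f (x + t *\<^sub>R d) - grad f x) \<bullet> d"
      by (simp add: inner_diff inner_commute)
    also have "\<dots> \<le> norm (grad f (x + t *\<^sub>R d) - grad f x) * norm d"
      by (rule norm_cauchy_schwarz)
    also have "\<dots> \<le> (L * (t * norm d)) * norm d"
      using lipschitz_onD[OF lip, of "x + t *\<^sub>R d" x] t
      by (intro mult_right_mono) (simp_all add: dist_norm)
    finally have "d \<bullet> grad f (x + t *\<^sub>R d) - grad f x \<bullet> d - L * t * (norm d)\<^sup>2 \<le> 0"
      by (simp add: power2_eq_square mult.assoc)
    with h' show "\<exists>z. DERIV h t :> z \<and> z \<le> 0" by blast
  qed simp
  then show ?thesis
    by (simp add: h_def d_def)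
qed

section \<open>Global trajectories of Lipschitz vector fields\<close>

lemma integral_has_vector_derivative_atLeast:
  fixes g :: "real \<Rightarrow> 'a::banach"
  assumes "continuous_on {0..} g" "t \<ge> 0"
  shows "((\<lambda>t. integral {0..t} g) has_vector_derivative g t) (at t within {0..})"
proof -
  \<comment> \<open>The interval reaches beyond \<open>t\<close>, so that near \<open>t\<close> it
    coincides with the half-line, even for \<open>t\<close> = 0.\<close>
  have "((\<lambda>t. integral {0..t} g) has_vector_derivative g t) (at t within {0..t+1})"
    using assms by (intro integral_has_vector_derivative continuous_on_subset[OF assms(1)]) auto
  moreover have "at t within {0..t+1} = at t within {0..}"
    using assms(2) by (intro at_within_nhd[of _ "{..<t+1}"]) auto
  ultimately show ?thesis by simp
qed

text \<open>With the weight exp (- K t), integration from 0 gains a factor 1/K. This makes the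
  Picard operator below both bounded and contracting.\<close>

lemma norm_integral_exp_bound:
  fixes g :: "real \<Rightarrow> 'a::banach"
  assumes cont: "continuous_on {0..} g" and "t \<ge> 0" "K > 0" "C \<ge> 0"
    and bound: "\<And>r. r \<ge> 0 \<Longrightarrow> norm (g r) \<le> C * exp (K * r)"
  shows "exp (- (K * t)) * norm (integral {0..t} g) \<le> C / K"
proof -
  have "((\<lambda>r. C * exp (K * r)) has_integral (C * exp (K * t) / K - C * exp (K * 0) / K)) {0..t}"
    using assms(2,3)
    by (intro fundamental_theorem_of_calculus)
      (auto intro!: derivative_eq_intros simp flip: has_real_derivative_iff_has_vector_derivative)
  then have "integral {0..t} (\<lambda>r. C * exp (K * r)) = C * exp (K * t) / K - C / K"
    and int: "(\<lambda>r. C * exp (K * r)) integrable_on {0..t}"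
    by (auto simp: has_integral_iff)
  moreover have "norm (integral {0..t} g) \<le> integral {0..t} (\<lambda>r. C * exp (K * r))"
    using bound
    by (intro integral_norm_bound_integral int integrable_continuous_real
        continuous_on_subset[OF cont]) auto
  ultimately have "norm (integral {0..t} g) \<le> C * exp (K * t) / K"
    using assms(3,4) by (smt (verit) divide_nonneg_pos)
  then have "exp (- (K * t)) * norm (integral {0..t} g) \<le> exp (- (K * t)) * (C * exp (K * t) / K)"
    by (intro mult_left_mono) auto
  also have "\<dots> = C / K"
    by (simp add: exp_minus)
  finally show ?thesis .
qed

text \<open>
  Picard iteration on the whole half-line: substituting \<open>p t = exp (K t) *\<^sub>R u t\<close> with \<open>K\<close> above the
  Lipschitz constant makes the integral operator a contraction on bounded continuous functions.
\<close>
lemma lipschitz_global_trajectory: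
  fixes X :: "'a::banach \<Rightarrow> 'a"
  assumes lip: "\<Lambda>-lipschitz_on UNIV X"
  shows "\<exists>p. trajectory X p \<and> p 0 = p0"
proof -
  \<comment> \<open>Adding 1 makes the ratio \<open>\<Lambda> / K\<close> smaller than 1 and keeps
    \<open>K\<close> positive even if \<open>\<Lambda>\<close> = 0.\<close>
  define K where "K = \<Lambda> + 1"
  have \<Lambda>: "\<Lambda> \<ge> 0" using lip by (rule lipschitz_on_nonneg)
  then have K: "K > 0" "\<Lambda> / K < 1" "0 \<le> \<Lambda> / K" by (auto simp: K_def)
  \<comment> \<open>\<open>G u\<close> is the field along the curve exp (K t) u(t); \<open>F\<close>
    is the integral operator for that curve, divided by exp (K t).\<close>
  define G where "G u r = X (exp (K * r) *\<^sub>R apply_bcontfun u r)" for u :: "real \<Rightarrow>\<^sub>C 'a" and r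
  define F where "F u t = exp (- (K * t)) *\<^sub>R (p0 + integral {0..t} (G u))" for u t
  have contX: "continuous_on UNIV X"
    using lip by (rule lipschitz_on_continuous_on)
  have contG: "continuous_on S (G u)" for S u
    unfolding G_def
    by (intro continuous_on_compose2[OF contX] continuous_intros) auto
  have derI: "((\<lambda>t. integral {0..t} (G u)) has_vector_derivative G u t) (at t within {0..})"
    if "t \<ge> 0" for t u
    by (rule integral_has_vector_derivative_atLeast[OF contG that])
  have contI: "continuous_on {0..} (\<lambda>t. integral {0..t} (G u))" for u
    by (rule continuous_on_vector_derivative) (use derI in auto)
  have contF: "continuous_on {0..} (F u)" for u
    unfolding F_def
    by (intro continuous_intros contI)
  have normG: "norm (G u r) \<le> (norm (X 0) + \<Lambda> * norm u) * exp (K * r)" if "r \<ge> 0" for u r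
  proof -
    have "norm (G u r) \<le> norm (X 0) + dist (G u r) (X 0)"
      unfolding dist_norm by norm
    also have "dist (G u r) (X 0) \<le> \<Lambda> * (exp (K * r) * norm (apply_bcontfun u r))"
      using lipschitz_onD[OF lip, of "exp (K * r) *\<^sub>R apply_bcontfun u r" 0]
      by (simp add: G_def)
    also have "\<dots> \<le> \<Lambda> * (exp (K * r) * norm u)"
      using \<Lambda> by (intro mult_left_mono norm_bounded) auto
    also have "norm (X 0) \<le> norm (X 0) * exp (K * r)"
      using K that mult_left_mono[of 1 "exp (K * r)" "norm (X 0)"] by simp
    finally show ?thesis by (simp add: algebra_simps)
  qed
  \<comment> \<open>Bounded continuous functions here live on the whole real line, so
    \<open>F u\<close> is frozen at its value at 0 for negative times. Only values of
    \<open>u\<close> at nonnegative times enter it.\<close>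
  have "(\<lambda>t. F u (max 0 t)) \<in> bcontfun" for u
  proof (rule bcontfun_normI)
    show "continuous_on UNIV (\<lambda>t. F u (max 0 t))"
      by (intro continuous_on_compose2[OF contF] continuous_intros) auto
    fix t :: real
    define r where "r = max 0 t"
    have "norm (F u r) \<le> exp (- (K * r)) * norm p0 + exp (- (K * r)) * norm (integral {0..r} (G u))"
      unfolding F_def norm_scaleR by (simp add: norm_triangle_ineq flip: distrib_left)
    also have "exp (- (K * r)) * norm (integral {0..r} (G u)) \<le> (norm (X 0) + \<Lambda> * norm u) / K"
      using K \<Lambda> by (intro norm_integral_exp_bound contG normG) (auto simp: r_def)
    also have "exp (- (K * r)) * norm p0 \<le> norm p0"
      using K by (intro mult_left_le_one_le) (auto simp: r_def)
    finally show "norm (F u (max 0 t)) \<le> norm p0 + (norm (X 0) + \<Lambda> * norm u) / K"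
      by (simp add: r_def)
  qed
  then have app: "apply_bcontfun (Bcontfun (\<lambda>t. F u (max 0 t))) t = F u (max 0 t)" for u t
    by (simp add: Bcontfun_inverse)
  have "dist (Bcontfun (\<lambda>t. F u (max 0 t))) (Bcontfun (\<lambda>t. F w (max 0 t))) \<le> \<Lambda> / K * dist u w" for u w
  proof (rule dist_bound)
    fix t :: real
    define r where "r = max 0 t"
    have "integral {0..r} (\<lambda>q. G u q - G w q) = integral {0..r} (G u) - integral {0..r} (G w)"
      by (intro integral_diff integrable_continuous_real contG)
    then have "F u r - F w r = exp (- (K * r)) *\<^sub>R integral {0..r} (\<lambda>q. G u q - G w q)"
      by (simp add: F_def flip: scaleR_diff_right)
    then have "dist (F u r) (F w r) = exp (- (K * r)) * norm (integral {0..r} (\<lambda>q. G u q - G w q))"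
      by (simp add: dist_norm)
    also have "\<dots> \<le> (\<Lambda> * dist u w) / K"
    proof (rule norm_integral_exp_bound)
      fix q :: real
      have "norm (G u q - G w q) \<le> \<Lambda> * (exp (K * q) * dist (apply_bcontfun u q) (apply_bcontfun w q))"
        using lipschitz_onD[OF lip, of "exp (K * q) *\<^sub>R apply_bcontfun u q" "exp (K * q) *\<^sub>R apply_bcontfun w q"]
        by (simp add: G_def dist_norm flip: scaleR_diff_right)
      also have "\<dots> \<le> \<Lambda> * (exp (K * q) * dist u w)"
        using \<Lambda> by (intro mult_left_mono dist_bounded) auto
      finally show "norm (G u q - G w q) \<le> \<Lambda> * dist u w * exp (K * q)"
        by (simp add: algebra_simps)
    qed (use K \<Lambda> in \<open>auto simp: r_def intro!: continuous_intros contG\<close>)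
    finally show "dist (apply_bcontfun (Bcontfun (\<lambda>t. F u (max 0 t))) t)
        (apply_bcontfun (Bcontfun (\<lambda>t. F w (max 0 t))) t) \<le> \<Lambda> / K * dist u w"
      by (simp add: app r_def)
  qed
  with banach_fix_type[of "\<Lambda> / K" "\<lambda>u. Bcontfun (\<lambda>t. F u (max 0 t))"] K
  obtain u where "Bcontfun (\<lambda>t. F u (max 0 t)) = u" by blast
  then have u: "apply_bcontfun u t = F u t" if "t \<ge> 0" for t
    using app[of u t] that by simp
  define p where "p t = exp (K * t) *\<^sub>R apply_bcontfun u t" for t
  \<comment> \<open>Undoing the weight turns the fixed point equation into the plain integral
    equation.\<close>
  have p: "p t = p0 + integral {0..t} (G u)" if "t \<ge> 0" for t
    using u[OF that] by (simp add: p_def F_def exp_minus)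
  have "trajectory X p"
    unfolding trajectory_def
  proof (intro allI impI)
    fix t :: real assume t: "t \<ge> 0"
    have "((\<lambda>t. p0 + integral {0..t} (G u)) has_vector_derivative 0 + G u t) (at t within {0..})"
      by (intro derivative_intros derI t)
    then show "(p has_vector_derivative X (p t)) (at t within {0..})"
      using t by (intro has_vector_derivative_transform[OF _ p]) (auto simp: G_def p_def)
  qed
  moreover have "p 0 = p0"
    by (simp add: p)
  ultimately show ?thesis by blast
qed

section \<open>The Lyapunov function\<close>

text \<open>Complete the square in \<open>N\<close> after multiplying by 4 A.\<close>

lemma quadratic_form_le:
  fixes A B C :: real
  assumes "A > 0" "B\<^sup>2 \<le> 4 * A * C"
  shows "B * N * G \<le> A * N\<^sup>2 + C * G\<^sup>2"
proof -
  have "0 \<le> (2 * A * N - B * G)\<^sup>2 + (4 * A * C - B\<^sup>2) * G\<^sup>2"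
    using assms by simp
  also have "\<dots> = 4 * A * (A * N\<^sup>2 + C * G\<^sup>2 - B * N * G)"
    by (simp add: power2_eq_square algebra_simps)
  finally show ?thesis
    using assms(1) by (simp add: zero_le_mult_iff)
qed

text \<open>Parallelogram law with the term |v - c w|^2 dropped.\<close>

lemma norm_add_scaleR_sq_le:
  fixes v w :: "'a::real_inner"
  shows "(norm (v + c *\<^sub>R w))\<^sup>2 \<le> 2 * (norm v)\<^sup>2 + 2 * c\<^sup>2 * (norm w)\<^sup>2"
proof -
  have "0 \<le> (norm (v - c *\<^sub>R w))\<^sup>2" by simp
  then show ?thesis
    unfolding power2_norm_eq_inner
    by (simp add: inner_diff inner_add inner_commute power2_eq_square)
qed

lemma has_derivative_inner_self:
  assumes "(u has_derivative u') (at p within S)"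
  shows "((\<lambda>p. u p \<bullet> u p) has_derivative (\<lambda>h. 2 * (u p \<bullet> u' h))) (at p within S)"
  using has_derivative_inner[OF assms assms] by (simp add: inner_commute)

locale heavy_ball =
  fixes f :: "'a::euclidean_space \<Rightarrow> real" and xs :: 'a and \<mu> L s :: real
  assumes mu_pos: "\<mu> > 0" and L_pos: "L > 0" and s_pos: "s > 0"
    and differentiable: "f differentiable (at x)"
    and strong_convexity: "strongly_convex \<mu> f"
    and grad_lipschitz: "L-lipschitz_on UNIV (grad f)"
    and minimum: "f xs \<le> f y"
begin

abbreviation m :: real where "m \<equiv> sqrt_mu_s \<mu> s"
abbreviation V :: "'a \<times> 'a \<Rightarrow> real" where "V \<equiv> V_hb \<mu> s f xs"
abbreviation X :: "real \<Rightarrow> 'a \<times> 'a \<Rightarrow> 'a \<times> 'a" where "X \<equiv> X_hb \<mu> s f"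

section \<open>Constants and standard estimates for strongly convex functions with Lipschitz
  gradient\<close>

lemma m_eq: "m = 1 + sqrt \<mu> * sqrt s"
  by (simp add: sqrt_mu_s_def real_sqrt_mult)

lemma m_gt_1: "m > 1"
  using mu_pos s_pos by (simp add: m_eq)

lemma m_pos: "m > 0"
  using m_gt_1 by simp

lemma sqrt_mu_pos: "sqrt \<mu> > 0"
  using mu_pos by simp

lemma sqrt_mu_sq: "sqrt \<mu> * sqrt \<mu> = \<mu>"
  using mu_pos by simp

lemma \<beta>_pos: "\<beta>1 \<mu> s > 0" "\<beta>2 \<mu> L s > 0" "\<beta>3 \<mu> > 0" "\<beta>4 \<mu> L s > 0"
  using mu_pos L_pos s_pos m_pos
  by (auto simp: \<beta>1_def \<beta>2_def \<beta>3_def \<beta>4_def intro!: divide_pos_pos mult_pos_pos add_pos_pos)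

lemma convexD: "grad f x \<bullet> (y - x) + \<mu> / 2 * (norm (x - y))\<^sup>2 \<le> f y - f x"
  using strong_convexity by (auto simp: strongly_convex_def)

lemma grad_diff_le: "norm (grad f x - grad f y) \<le> L * norm (x - y)"
  using lipschitz_onD[OF grad_lipschitz, of x y] by (simp add: dist_norm)

text \<open>Add the strong convexity inequalities for the two orders of the points; the function
  values cancel.\<close>

lemma strong_monotonicity: "\<mu> * (norm (y - x))\<^sup>2 \<le> (grad f y - grad f x) \<bullet> (y - x)"
  using convexD[of x y] convexD[of y x]
  by (simp add: inner_diff norm_minus_commute algebra_simps)

text \<open>A gradient step of length 1/L lowers f by at least |grad f x|^2 / (2 L), yet cannot go
  below the minimum.\<close>

lemma grad_sq_le: "(norm (grad f x))\<^sup>2 / (2 * L) \<le> f x - f xs"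
proof -
  have "f xs \<le> f (x - (1 / L) *\<^sub>R grad f x)" by (rule minimum)
  also have "\<dots> \<le> f x - (norm (grad f x))\<^sup>2 / L + L / 2 * (norm (grad f x) / L)\<^sup>2"
    using descent_lemma[OF differentiable grad_lipschitz, of "x - (1 / L) *\<^sub>R grad f x" x] L_pos
    by (simp add: power2_norm_eq_inner)
  also have "\<dots> = f x - (norm (grad f x))\<^sup>2 / (2 * L)"
    using L_pos by (simp add: power2_eq_square field_simps)
  finally show ?thesis by simp
qed

lemma grad_xs: "grad f xs = 0"
  using grad_sq_le[of xs] L_pos by (simp add: divide_le_0_iff)

lemma f_gap_le: "f x - f xs \<le> L / 2 * (norm (x - xs))\<^sup>2"
  using descent_lemma[OF differentiable grad_lipschitz, of x xs] by (simp add: grad_xs)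

lemma f_gap_ge: "\<mu> / 2 * (norm (x - xs))\<^sup>2 \<le> f x - f xs"
  using convexD[of xs x] by (simp add: grad_xs norm_minus_commute)

lemma grad_le: "norm (grad f x) \<le> L * norm (x - xs)"
  using grad_diff_le[of x xs] by (simp add: grad_xs)

text \<open>Strong monotonicity against \<open>xs\<close> and Cauchy-Schwarz, cancelling one factor
  |x - xs|. It later trades |e| for |g| in the cross term.\<close>

lemma grad_ge: "\<mu> * norm (x - xs) \<le> norm (grad f x)"
proof (cases "x = xs")
  case False
  have "\<mu> * (norm (x - xs))\<^sup>2 \<le> grad f x \<bullet> (x - xs)"
    using strong_monotonicity[where x=xs and y=x] by (simp add: grad_xs)
  also have "\<dots> \<le> norm (grad f x) * norm (x - xs)"
    by (rule norm_cauchy_schwarz)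
  finally show ?thesis
    using False by (simp add: power2_eq_square flip: mult.assoc)
qed simp

section \<open>The gradient of V and its derivative along the dynamics\<close>

lemma GDERIV_V:
  "GDERIV V (x, v) :> (m *\<^sub>R grad f x + sqrt \<mu> *\<^sub>R v + (2 * \<mu>) *\<^sub>R (x - xs), v + sqrt \<mu> *\<^sub>R (x - xs))"
proof -
  define e where "e = x - xs"
  have "(f has_derivative (\<lambda>h. h \<bullet> grad f x)) (at x)"
    using GDERIV_grad[OF differentiable] by (simp add: gderiv_def)
  then have f: "((\<lambda>p. f (fst p)) has_derivative (\<lambda>h. fst h \<bullet> grad f x)) (at (x, v))"
    using has_derivative_compose[OF has_derivative_fst[OF has_derivative_ident], of f _ "(x, v)" UNIV] by simp
  have w: "((\<lambda>p. snd p + (2 * sqrt \<mu>) *\<^sub>R (fst p - xs)) has_derivative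
      (\<lambda>h. snd h + (2 * sqrt \<mu>) *\<^sub>R fst h)) (at (x, v))"
    by (auto intro!: derivative_eq_intros)
  \<comment> \<open>Inner products replace the squared norms, since the norm itself is not
    differentiable at 0.\<close>
  have V: "V = (\<lambda>p. m * (f (fst p) - f xs) + 1 / 4 * (snd p \<bullet> snd p)
      + 1 / 4 * ((snd p + (2 * sqrt \<mu>) *\<^sub>R (fst p - xs)) \<bullet> (snd p + (2 * sqrt \<mu>) *\<^sub>R (fst p - xs))))"
    by (auto simp: V_hb_def power2_norm_eq_inner)
  have "(V has_derivative (\<lambda>h. m * (fst h \<bullet> grad f x - 0) + 1 / 4 * (2 * (v \<bullet> snd h))
      + 1 / 4 * (2 * ((v + (2 * sqrt \<mu>) *\<^sub>R e) \<bullet> (snd h + (2 * sqrt \<mu>) *\<^sub>R fst h))))) (at (x, v))"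
    unfolding V e_def
    using has_derivative_inner_self[OF w] has_derivative_inner_self[OF has_derivative_snd[OF has_derivative_ident], of "(x, v)" UNIV]
    by (intro has_derivative_add has_derivative_mult_right has_derivative_diff f has_derivative_const) simp_all
  moreover have "sqrt \<mu> * (sqrt \<mu> * r) = \<mu> * r" for r
    by (simp only: sqrt_mu_sq flip: mult.assoc)
  ultimately show ?thesis
    unfolding gderiv_def e_def[symmetric]
    by (elim has_derivative_eq_rhs)
      (simp add: fun_eq_iff inner_add inner_commute[of v] inner_commute[of e] algebra_simps)
qed

lemma grad_V:
  "grad V (x, v) = (m *\<^sub>R grad f x + sqrt \<mu> *\<^sub>R v + (2 * \<mu>) *\<^sub>R (x - xs), v + sqrt \<mu> *\<^sub>R (x - xs))"
  by (rule grad_eqI[OF GDERIV_V])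

text \<open>Here 3/4 is 1/4 from the kinetic term plus (1/4) * 2 from splitting the mixed square,
  which also yields 2 mu = (1/4) * 2 * (2 sqrt mu)^2.\<close>

lemma V_upper: "V (x, v) \<le> m * (f x - f xs) + 3 / 4 * (norm v)\<^sup>2 + 2 * \<mu> * (norm (x - xs))\<^sup>2"
  using norm_add_scaleR_sq_le[of v "2 * sqrt \<mu>" "x - xs"] mu_pos
  by (simp add: V_hb_def power_mult_distrib)

text \<open>The terms in <x - xs, v> cancel: 2 mu from the gradient of V in x against - 2 mu from
  the damping. The damping also turns + sqrt mu |v|^2 into - sqrt mu |v|^2.\<close>

lemma derivative_V_eq:
  "grad V (x, v) \<bullet> X a (x, v) = - sqrt \<mu> * (norm v)\<^sup>2 - m * ((grad f (x + a *\<^sub>R v) - grad f x) \<bullet> v)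
    - m * sqrt \<mu> * ((x - xs) \<bullet> grad f (x + a *\<^sub>R v))"
proof -
  have sq: "sqrt \<mu> * (sqrt \<mu> * r) = \<mu> * r" for r
    by (simp only: sqrt_mu_sq flip: mult.assoc)
  show ?thesis
    by (simp add: sq grad_V X_hb_def power2_norm_eq_inner inner_add inner_diff inner_commute algebra_simps)
qed

text \<open>Multiplied by b2^2 and with the square in a completed, the claim reads (a b2^2 - 2 b1
  b4)^2 <= (2 R)^2. The bound by \<open>a1_star\<close> is exactly a b2^2 - 2 b1 b4 <= 2 R.\<close>

lemma a1_star_quadratic:
  assumes "0 \<le> a" "a \<le> a1_star \<mu> L s"
  shows "(a * \<beta>2 \<mu> L s)\<^sup>2 \<le> 4 * (\<beta>3 \<mu> + a * \<beta>1 \<mu> s) * \<beta>4 \<mu> L s"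
proof -
  define b1 b2 b3 b4 where "b1 = \<beta>1 \<mu> s" "b2 = \<beta>2 \<mu> L s" "b3 = \<beta>3 \<mu>" "b4 = \<beta>4 \<mu> L s"
  have pos: "b1 > 0" "b2 > 0" "b3 > 0" "b4 > 0"
    using \<beta>_pos by (auto simp: b1_b2_b3_b4_def)
  define R where "R = sqrt (b2\<^sup>2 * b3 * b4 + b1\<^sup>2 * b4\<^sup>2)"
  have R2: "R\<^sup>2 = b2\<^sup>2 * b3 * b4 + b1\<^sup>2 * b4\<^sup>2"
    using pos by (simp add: R_def)
  \<comment> \<open>Since b1 b4 <= R, the other root is nonpositive, so \<open>a\<close> >= 0
    supplies the lower half of the absolute value bound.\<close>
  have "(b1 * b4)\<^sup>2 \<le> R\<^sup>2" using pos by (simp add: R2 power_mult_distrib)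
  moreover have R0: "R \<ge> 0" using pos by (simp add: R_def)
  ultimately have "b1 * b4 \<le> R" by (rule power2_le_imp_le)
  moreover have "a * b2\<^sup>2 \<le> 2 * (b1 * b4 + R)"
    using assms(2) pos
    by (simp add: a1_star_def R_def field_simps flip: b1_b2_b3_b4_def)
  moreover have "a * b2\<^sup>2 \<ge> 0" using assms(1) by simp
  ultimately have "\<bar>a * b2\<^sup>2 - 2 * (b1 * b4)\<bar> \<le> \<bar>2 * R\<bar>"
    using R0 by (simp add: abs_le_iff)
  then have "(a * b2\<^sup>2 - 2 * (b1 * b4))\<^sup>2 \<le> (2 * R)\<^sup>2"
    by (simp only: abs_le_square_iff)
  then have "b2\<^sup>2 * (a * b2)\<^sup>2 \<le> b2\<^sup>2 * (4 * (b3 + a * b1) * b4)"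
    unfolding power_mult_distrib[of 2 R] R2 by (simp add: power2_eq_square algebra_simps)
  then have "(a * b2)\<^sup>2 \<le> 4 * (b3 + a * b1) * b4"
    using pos by simp
  then show ?thesis by (simp add: b1_b2_b3_b4_def)
qed

text \<open>The constants come from a budget. Convexity makes m sqrt mu <e, g> pay for m sqrt mu gap
  and m sqrt mu (mu/2) |e|^2. The term (sqrt mu / 4) V consumes 1/4 of the gap term, the part sqrt
  mu (mu/2) |e|^2, and 3/16 of sqrt mu |v|^2. The rest of the velocity term is
  \<open>\<beta>3\<close>; the rest of the gap and |e|^2 terms dominates \<open>\<beta>4\<close>
  |g|^2.\<close>

lemma derivative_V_le:
  assumes "0 \<le> a" "a \<le> a1_star \<mu> L s"
  shows "grad V p \<bullet> X a p \<le> - (sqrt \<mu> / 4) * V p"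
proof -
  obtain x v where p: "p = (x, v)" by fastforce
  define e g g' where "e = x - xs" "g = grad f x" "g' = grad f (x + a *\<^sub>R v)"
  note defs = e_g_g'_def
  define gap where "gap = f x - f xs"
  \<comment> \<open>Strong monotonicity for the displacement a v, divided by \<open>a\<close>; for
    \<open>a\<close> = 0 both sides vanish.\<close>
  have mono: "a * \<mu> * (norm v)\<^sup>2 \<le> (g' - g) \<bullet> v"
  proof (cases "a = 0")
    case False
    have "a * (a * \<mu> * (norm v)\<^sup>2) \<le> a * ((g' - g) \<bullet> v)"
      using strong_monotonicity[of "x + a *\<^sub>R v" x]
      by (simp add: defs power_mult_distrib power2_eq_square algebra_simps)
    with False assms(1) show ?thesis by simp
  qed (simp add: defs)
  have "- (e \<bullet> (g' - g)) \<le> norm e * norm (g' - g)"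
    using Cauchy_Schwarz_ineq2[of e "g' - g"] by linarith
  \<comment> \<open>Bounding |e| by |g| / mu leaves only |v| |g|, with coefficient m sqrt mu L a /
    mu = a \<open>\<beta>2\<close>.\<close>
  also have "\<dots> \<le> (norm g / \<mu>) * (L * (a * norm v))"
    using grad_ge[of x] grad_diff_le[of "x + a *\<^sub>R v" x] mu_pos assms(1)
    by (intro mult_mono) (simp_all add: defs field_simps)
  finally have "m * sqrt \<mu> * - (e \<bullet> (g' - g)) \<le> m * sqrt \<mu> * ((norm g / \<mu>) * (L * (a * norm v)))"
    using m_pos sqrt_mu_pos by (intro mult_left_mono) auto
  also have "\<dots> = a * \<beta>2 \<mu> L s * norm v * norm g"
    using sqrt_mu_pos sqrt_mu_sq by (simp add: \<beta>2_def field_simps)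
  finally have cross: "- (m * sqrt \<mu> * (e \<bullet> (g' - g))) \<le> a * \<beta>2 \<mu> L s * norm v * norm g"
    by simp
  have conv: "gap + \<mu> / 2 * (norm e)\<^sup>2 \<le> e \<bullet> g"
    using convexD[of x xs] by (simp add: defs gap_def inner_diff inner_commute algebra_simps)
  \<comment> \<open>The two leftovers are converted into |g|^2: three quarters of the gap by
    \<open>grad_sq_le\<close>, the |e|^2 term by |g| <= L |e|. The resulting coefficients add up to
    \<open>\<beta>4\<close>.\<close>
  have "L * (3 / 4) * m * sqrt \<mu> * ((norm g)\<^sup>2 / (2 * L)) \<le> L * (3 / 4) * m * sqrt \<mu> * gap"
    using grad_sq_le[of x] L_pos m_pos sqrt_mu_pos by (intro mult_left_mono) (auto simp: defs gap_def)
  then have gap': "3 * m * sqrt \<mu> / (8 * L) * (norm g)\<^sup>2 \<le> 3 / 4 * (m * sqrt \<mu> * gap)"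
    using L_pos by (simp add: field_simps)
  have "(norm g)\<^sup>2 \<le> (L * norm e)\<^sup>2"
    using grad_le[of x] by (intro power_mono) (auto simp: defs)
  then have "\<mu>\<^sup>2 * sqrt s / (2 * L\<^sup>2) * (norm g)\<^sup>2 \<le> \<mu>\<^sup>2 * sqrt s / (2 * L\<^sup>2) * (L * norm e)\<^sup>2"
    using s_pos by (intro mult_left_mono) auto
  then have e': "\<mu>\<^sup>2 * sqrt s / (2 * L\<^sup>2) * (norm g)\<^sup>2 \<le> \<mu>\<^sup>2 * sqrt s * (norm e)\<^sup>2 / 2"
    using L_pos by (simp add: power_mult_distrib)
  have b4: "\<beta>4 \<mu> L s * (norm g)\<^sup>2 = \<mu>\<^sup>2 * sqrt s / (2 * L\<^sup>2) * (norm g)\<^sup>2 + 3 * m * sqrt \<mu> / (8 * L) * (norm g)\<^sup>2"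
    using L_pos by (simp add: \<beta>4_def power2_eq_square field_simps)
  have b4_le: "\<beta>4 \<mu> L s * (norm g)\<^sup>2 \<le> \<mu>\<^sup>2 * sqrt s * (norm e)\<^sup>2 / 2 + 3 / 4 * (m * sqrt \<mu> * gap)"
    using b4 e' gap' by linarith
  have quad: "a * \<beta>2 \<mu> L s * norm v * norm g \<le> (\<beta>3 \<mu> + a * \<beta>1 \<mu> s) * (norm v)\<^sup>2 + \<beta>4 \<mu> L s * (norm g)\<^sup>2"
    using \<beta>_pos assms by (intro quadratic_form_le a1_star_quadratic add_pos_nonneg) auto
  have V4: "sqrt \<mu> / 4 * V p \<le> sqrt \<mu> / 4 * (m * gap + 3 / 4 * (norm v)\<^sup>2 + 2 * \<mu> * (norm e)\<^sup>2)"
    unfolding p using V_upper[of x v] sqrt_mu_pos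
    by (intro mult_left_mono) (auto simp: gap_def defs)
  have mono': "m * (a * \<mu> * (norm v)\<^sup>2) \<le> m * ((g' - g) \<bullet> v)"
    using mono m_pos by (intro mult_left_mono) auto
  have conv': "m * sqrt \<mu> * (gap + \<mu> / 2 * (norm e)\<^sup>2) \<le> m * sqrt \<mu> * (e \<bullet> g)"
    using conv m_pos sqrt_mu_pos by (intro mult_left_mono) auto
  \<comment> \<open>Writing m sqrt mu = sqrt mu + mu sqrt s separates the part of |e|^2 that V uses
    up from the surplus kept for \<open>\<beta>4\<close>.\<close>
  have ee: "m * sqrt \<mu> * (\<mu> / 2) * (norm e)\<^sup>2 = sqrt \<mu> * \<mu> / 2 * (norm e)\<^sup>2 + \<mu>\<^sup>2 * sqrt s / 2 * (norm e)\<^sup>2"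
  proof -
    have "m * sqrt \<mu> = sqrt \<mu> + \<mu> * sqrt s"
      unfolding m_eq using sqrt_mu_sq by (simp add: distrib_right mult.assoc mult.left_commute)
    then show ?thesis by (simp add: power2_eq_square algebra_simps)
  qed
  have split: "m * sqrt \<mu> * (e \<bullet> g') = m * sqrt \<mu> * (e \<bullet> g) + m * sqrt \<mu> * (e \<bullet> (g' - g))"
    by (simp add: inner_diff algebra_simps)
  have V4_le: "sqrt \<mu> / 4 * V p \<le>
      m * sqrt \<mu> * gap / 4 + 3 / 16 * (sqrt \<mu> * (norm v)\<^sup>2) + sqrt \<mu> * \<mu> * (norm e)\<^sup>2 / 2"
    using V4 by (simp add: algebra_simps)
  have conv_le: "m * sqrt \<mu> * gap + sqrt \<mu> * \<mu> * (norm e)\<^sup>2 / 2 + \<mu>\<^sup>2 * sqrt s * (norm e)\<^sup>2 / 2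
      \<le> m * sqrt \<mu> * (e \<bullet> g)"
    using conv' ee by (simp add: algebra_simps add_divide_distrib)
  have quad_le: "a * \<beta>2 \<mu> L s * norm v * norm g \<le>
      13 / 16 * (sqrt \<mu> * (norm v)\<^sup>2) + m * (a * \<mu> * (norm v)\<^sup>2) + \<beta>4 \<mu> L s * (norm g)\<^sup>2"
    using quad by (simp add: \<beta>1_def \<beta>3_def algebra_simps)
  have "grad V p \<bullet> X a p = - (sqrt \<mu> * (norm v)\<^sup>2) - m * ((g' - g) \<bullet> v) - m * sqrt \<mu> * (e \<bullet> g')"
    unfolding p derivative_V_eq defs by simp
  with mono' cross conv_le b4_le quad_le V4_le split
  have "grad V p \<bullet> X a p \<le> - (sqrt \<mu> / 4 * V p)"
    by linarith
  then show ?thesis by simp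
qed

section \<open>Comparison of V with the squared distance, exponential decay and stability\<close>

lemma dist_equilibrium_sq: "(dist (x, v) (xs, 0))\<^sup>2 = (norm (x - xs))\<^sup>2 + (norm v)\<^sup>2"
  unfolding dist_Pair_Pair by (simp add: dist_norm)

text \<open>Strong convexity and m > 1 let the gap term control the position, while |v|^2 / 4
  controls the velocity; the mixed square is dropped.\<close>

lemma V_lower: "min (\<mu> / 2) (1 / 4) * (dist p (xs, 0))\<^sup>2 \<le> V p"
proof -
  obtain x v where p: "p = (x, v)" by fastforce
  have "min (\<mu> / 2) (1 / 4) * (norm (x - xs))\<^sup>2 \<le> \<mu> / 2 * (norm (x - xs))\<^sup>2"
    by (intro mult_right_mono) auto
  also have "\<dots> \<le> f x - f xs"
    by (rule f_gap_ge)
  also have "\<dots> \<le> m * (f x - f xs)"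
    using mult_right_mono[of 1 m "f x - f xs"] m_gt_1 minimum[of x] by simp
  finally have "min (\<mu> / 2) (1 / 4) * (norm (x - xs))\<^sup>2 \<le> m * (f x - f xs)" .
  moreover have "min (\<mu> / 2) (1 / 4) * (norm v)\<^sup>2 \<le> 1 / 4 * (norm v)\<^sup>2"
    by (intro mult_right_mono) auto
  ultimately show ?thesis
    unfolding p dist_equilibrium_sq V_hb_def prod.case distrib_left
    using zero_le_power2[of "norm (v + (2 * sqrt \<mu>) *\<^sub>R (x - xs))"] by linarith
qed

lemma V_le_dist: "V p \<le> (m * L / 2 + 3 / 4 + 2 * \<mu>) * (dist p (xs, 0))\<^sup>2"
proof -
  obtain x v where p: "p = (x, v)" by fastforce
  have "m * (f x - f xs) \<le> m * (L / 2 * (norm (x - xs))\<^sup>2)"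
    using m_pos by (intro mult_left_mono f_gap_le) auto
  moreover have "m * L / 2 * (norm v)\<^sup>2 \<ge> 0" "2 * \<mu> * (norm v)\<^sup>2 \<ge> 0"
    using m_pos L_pos mu_pos by auto
  moreover have "(m * L / 2 + 3 / 4 + 2 * \<mu>) * ((norm (x - xs))\<^sup>2 + (norm v)\<^sup>2) =
      m * (L / 2 * (norm (x - xs))\<^sup>2) + 3 / 4 * (norm (x - xs))\<^sup>2 + 2 * \<mu> * (norm (x - xs))\<^sup>2
      + m * L / 2 * (norm v)\<^sup>2 + 3 / 4 * (norm v)\<^sup>2 + 2 * \<mu> * (norm v)\<^sup>2"
    by (simp add: algebra_simps)
  ultimately show ?thesis
    using V_upper[of x v] zero_le_power2[of "norm (x - xs)"]
    unfolding p dist_equilibrium_sq by linarith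
qed

text \<open>Gronwall argument: the dissipation inequality says that V weighted by exp (sqrt mu t /
  4) is nonincreasing along the trajectory.\<close>

lemma V_decay:
  assumes a: "0 \<le> a" "a \<le> a1_star \<mu> L s" and traj: "trajectory (X a) p" and t: "t \<ge> 0"
  shows "V (p t) \<le> V (p 0) * exp (- (sqrt \<mu> / 4) * t)"
proof -
  define c where "c = sqrt \<mu> / 4"
  define W where "W t = exp (c * t) * V (p t)" for t
  have W: "(W has_real_derivative exp (c * r) * (c * V (p r) + grad V (p r) \<bullet> X a (p r))) (at r within {0..})"
    if "r \<ge> 0" for r
  proof -
    have "(V has_derivative (\<lambda>h. h \<bullet> grad V (p r))) (at (p r))"
      using GDERIV_V[of "fst (p r)" "snd (p r)"] grad_V[of "fst (p r)" "snd (p r)"] by (simp add: gderiv_def)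
    moreover have "(p has_derivative (\<lambda>h. h *\<^sub>R X a (p r))) (at r within {0..})"
      using traj that by (simp add: trajectory_def has_vector_derivative_def)
    ultimately have "((\<lambda>t. V (p t)) has_real_derivative grad V (p r) \<bullet> X a (p r)) (at r within {0..})"
      using has_derivative_compose[of p "\<lambda>h. h *\<^sub>R X a (p r)" r "{0..}" V "\<lambda>h. h \<bullet> grad V (p r)"]
      by (simp add: has_field_derivative_def inner_commute mult_commute_abs)
    then show ?thesis
      unfolding W_def by (auto intro!: derivative_eq_intros simp: algebra_simps)
  qed
  have "W t \<le> W 0"
  \<comment> \<open>At time 0 the trajectory has only a one-sided derivative, so derivatives are
    used at interior times and continuity covers the endpoints.\<close>
  proof (rule DERIV_nonpos_imp_decreasing_open[OF t])
    fix r assume r: "0 < r" "r < t"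
    have "(W has_real_derivative exp (c * r) * (c * V (p r) + grad V (p r) \<bullet> X a (p r))) (at r)"
      using W[of r] r by (simp add: at_within_interior[of r "{0..}"])
    moreover have "exp (c * r) * (c * V (p r) + grad V (p r) \<bullet> X a (p r)) \<le> 0"
      using derivative_V_le[OF a, of "p r"] by (simp add: c_def mult_le_0_iff)
    ultimately show "\<exists>y. DERIV W r :> y \<and> y \<le> 0" by blast
  next
    have "continuous_on {0..} W"
      using W by (intro DERIV_continuous_on) auto
    then show "continuous_on {0..t} W"
      by (rule continuous_on_subset) auto
  qed
  then have "exp (- (c * t)) * (exp (c * t) * V (p t)) \<le> exp (- (c * t)) * V (p 0)"
    by (intro mult_left_mono) (auto simp: W_def)
  then have "V (p t) \<le> V (p 0) * exp (- c * t)"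
    by (simp add: exp_minus field_simps)
  then show ?thesis
    by (simp add: c_def)
qed

text \<open>Gives existence of trajectories for all times. The summands of the constant account for
  the velocity component, the damping and the displaced gradient, in this order.\<close>

lemma X_lipschitz:
  assumes "a \<ge> 0"
  shows "(1 + 2 * sqrt \<mu> + m * (L * (1 + a)))-lipschitz_on UNIV (X a)"
proof (rule lipschitz_onI)
  fix p q :: "'a \<times> 'a"
  obtain x v y w where p: "p = (x, v)" and q: "q = (y, w)" by fastforce
  define d where "d = dist p q"
  have x: "norm (x - y) \<le> d" and v: "norm (v - w) \<le> d"
    using dist_fst_le[of p q] dist_snd_le[of p q] by (simp_all add: d_def p q dist_norm)
  let ?g = "grad f (x + a *\<^sub>R v) - grad f (y + a *\<^sub>R w)"
  have "norm ?g \<le> L * norm ((x - y) + a *\<^sub>R (v - w))"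
    using grad_diff_le[of "x + a *\<^sub>R v" "y + a *\<^sub>R w"] by (simp add: algebra_simps)
  also have "\<dots> \<le> L * (d + a * d)"
    using norm_triangle_ineq[of "x - y" "a *\<^sub>R (v - w)"] x mult_left_mono[OF v assms] L_pos assms
    by (intro mult_left_mono) auto
  finally have g: "m * norm ?g \<le> m * (L * (d + a * d))"
    using m_pos by (intro mult_left_mono) auto
  have "norm (X a p - X a q) \<le> norm (v - w) + norm (- (2 * sqrt \<mu>) *\<^sub>R (v - w) - m *\<^sub>R ?g)"
    using norm_Pair_le[of "v - w" "- (2 * sqrt \<mu>) *\<^sub>R (v - w) - m *\<^sub>R ?g"]
    by (simp add: p q X_hb_def algebra_simps)
  also have "\<dots> \<le> norm (v - w) + (2 * sqrt \<mu> * norm (v - w) + m * norm ?g)"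
    using norm_triangle_ineq4[of "- (2 * sqrt \<mu>) *\<^sub>R (v - w)" "m *\<^sub>R ?g"] m_pos mu_pos by simp
  also have "\<dots> \<le> d + (2 * sqrt \<mu> * d + m * (L * (d + a * d)))"
    using v g mult_left_mono[OF v, of "2 * sqrt \<mu>"] sqrt_mu_pos by linarith
  finally show "dist (X a p) (X a q) \<le> (1 + 2 * sqrt \<mu> + m * (L * (1 + a))) * dist p q"
    by (simp add: dist_norm d_def algebra_simps)
next
  show "0 \<le> 1 + 2 * sqrt \<mu> + m * (L * (1 + a))"
    using assms m_pos L_pos sqrt_mu_pos by simp
qed

text \<open>Sandwiching V between multiples \<open>c\<close> and \<open>B\<close> of the squared
  distance and taking roots gives the constant sqrt (B / c) and halves the rate to sqrt mu /
  8.\<close>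

lemma trajectory_dist_bound:
  obtains C where "C > 0"
    "\<And>a p t. \<lbrakk>0 \<le> a; a \<le> a1_star \<mu> L s; trajectory (X a) p; t \<ge> 0\<rbrakk> \<Longrightarrow>
      dist (p t) (xs, 0) \<le> C * exp (- (sqrt \<mu> / 8) * t) * dist (p 0) (xs, 0)"
proof -
  define c where "c = min (\<mu> / 2) (1 / 4)"
  define B where "B = m * L / 2 + 3 / 4 + 2 * \<mu>"
  have c: "c > 0" and B: "B > 0"
    using mu_pos m_pos L_pos by (auto simp: c_def B_def add_pos_pos)
  show thesis
  proof (rule that)
    show "sqrt (B / c) > 0" using c B by simp
    fix a p t assume *: "0 \<le> a" "a \<le> a1_star \<mu> L s" "trajectory (X a) p" "(t::real) \<ge> 0"
    have "c * (dist (p t) (xs, 0))\<^sup>2 \<le> V (p t)"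
      unfolding c_def by (rule V_lower)
    also have "\<dots> \<le> V (p 0) * exp (- (sqrt \<mu> / 4) * t)"
      by (rule V_decay[OF *])
    also have "\<dots> \<le> (B * (dist (p 0) (xs, 0))\<^sup>2) * exp (- (sqrt \<mu> / 4) * t)"
      unfolding B_def by (intro mult_right_mono V_le_dist) auto
    finally have "(dist (p t) (xs, 0))\<^sup>2 \<le> B / c * exp (- (sqrt \<mu> / 4) * t) * (dist (p 0) (xs, 0))\<^sup>2"
      using c by (simp add: field_simps)
    also have "exp (- (sqrt \<mu> / 4) * t) = (exp (- (sqrt \<mu> / 8) * t))\<^sup>2"
      by (simp flip: exp_double)
    also have "B / c = (sqrt (B / c))\<^sup>2"
      using B c by simp
    finally have "(dist (p t) (xs, 0))\<^sup>2 \<le> (sqrt (B / c) * exp (- (sqrt \<mu> / 8) * t) * dist (p 0) (xs, 0))\<^sup>2"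
      by (simp only: power_mult_distrib)
    then show "dist (p t) (xs, 0) \<le> sqrt (B / c) * exp (- (sqrt \<mu> / 8) * t) * dist (p 0) (xs, 0)"
      by (rule power2_le_imp_le) (use B c in auto)
  qed
qed

lemma X_equilibrium: "X a (xs, 0) = 0"
  by (simp add: X_hb_def grad_xs zero_prod_def)

lemma asymptotic_stability:
  assumes a: "0 \<le> a" "a \<le> a1_star \<mu> L s"
  shows "globally_asymptotically_stable (X a) (xs, 0)"
proof -
  obtain C where C: "C > 0" and decay: "\<And>p t. trajectory (X a) p \<Longrightarrow> t \<ge> 0 \<Longrightarrow>
      dist (p t) (xs, 0) \<le> C * exp (- (sqrt \<mu> / 8) * t) * dist (p 0) (xs, 0)"
    using trajectory_dist_bound a by metis
  have "\<exists>\<delta>>0. \<forall>p. trajectory (X a) p \<longrightarrow> dist (p 0) (xs, 0) < \<delta> \<longrightarrow> (\<forall>t\<ge>0. dist (p t) (xs, 0) < \<epsilon>)"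
    if "\<epsilon> > 0" for \<epsilon>
  \<comment> \<open>The exponential factor is at most 1, so the distance never exceeds
    \<open>C\<close> times its initial value.\<close>
  proof (intro exI[of _ "\<epsilon> / C"] conjI allI impI)
    fix p and t :: real
    assume *: "trajectory (X a) p" "dist (p 0) (xs, 0) < \<epsilon> / C" "t \<ge> 0"
    have "dist (p t) (xs, 0) \<le> C * exp (- (sqrt \<mu> / 8) * t) * dist (p 0) (xs, 0)"
      by (rule decay[OF *(1,3)])
    also have "\<dots> \<le> C * 1 * dist (p 0) (xs, 0)"
      using C *(3) sqrt_mu_pos by (intro mult_right_mono mult_left_mono) auto
    also have "\<dots> < \<epsilon>"
      using C *(2) by (simp add: field_simps)
    finally show "dist (p t) (xs, 0) < \<epsilon>" .
  qed (use that C in simp)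
  moreover have "(p \<longlongrightarrow> (xs, 0)) at_top" if "trajectory (X a) p" for p
  proof (rule metric_tendsto_imp_tendsto)
    have "filterlim (\<lambda>t. sqrt \<mu> / 8 * t) at_top at_top"
      using sqrt_mu_pos
      by (intro filterlim_tendsto_pos_mult_at_top[OF tendsto_const] filterlim_ident) auto
    then have "((\<lambda>t. exp (- (sqrt \<mu> / 8 * t))) \<longlongrightarrow> 0) at_top"
      by (intro filterlim_compose[OF exp_at_bot] filterlim_compose[OF filterlim_uminus_at_bot_at_top])
    then have "((\<lambda>t. C * exp (- (sqrt \<mu> / 8 * t)) * dist (p 0) (xs, 0)) \<longlongrightarrow> C * 0 * dist (p 0) (xs, 0)) at_top"
      by (intro tendsto_intros)
    then show "((\<lambda>t. C * exp (- (sqrt \<mu> / 8) * t) * dist (p 0) (xs, 0)) \<longlongrightarrow> 0) at_top"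
      by simp
    show "\<forall>\<^sub>F t in at_top. dist (p t) (xs, 0) \<le> dist (C * exp (- (sqrt \<mu> / 8) * t) * dist (p 0) (xs, 0)) 0"
      using eventually_ge_at_top[of 0]
    proof eventually_elim
      case (elim t)
      then show ?case using decay[OF that elim] C by (simp add: dist_norm)
    qed
  qed
  ultimately show ?thesis
    unfolding globally_asymptotically_stable_def
    using X_equilibrium lipschitz_global_trajectory[OF X_lipschitz[OF a(1)]] by blast
qed

section \<open>The value of V at the prescribed initial condition, and the constant 7/2\<close>

lemma V_initial:
  assumes sL: "s \<le> 1 / L"
  shows "V (x, - (2 * sqrt s / m) *\<^sub>R grad f x) \<le> m * (7 * (norm (x - xs))\<^sup>2 / (2 * s))"
proof (cases "x = xs")
  case True
  then show ?thesis by (simp add: V_hb_def grad_xs)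
next
  case False
  define E where "E = norm (x - xs)"
  define \<sigma> where "\<sigma> = sqrt s"
  have \<sigma>: "\<sigma> > 0" and s: "s = \<sigma>\<^sup>2" using s_pos by (auto simp: \<sigma>_def)
  have E: "E > 0" using False by (simp add: E_def)
  have sL1: "s * L \<le> 1" using sL L_pos by (simp add: field_simps)
  \<comment> \<open>For x different from \<open>xs\<close>, comparing the two quadratic bounds on
    the gap gives mu <= L, hence mu s <= 1 and m <= 2.\<close>
  have "\<mu> / 2 * E\<^sup>2 \<le> L / 2 * E\<^sup>2"
    using f_gap_le[of x] f_gap_ge[of x] unfolding E_def by linarith
  then have "\<mu> \<le> L" using E by simp
  then have "s * \<mu> \<le> 1"
    using sL1 mult_left_mono[of \<mu> L s] s_pos by linarith
  then have q1: "sqrt \<mu> * \<sigma> \<le> 1"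
    by (simp add: \<sigma>_def mult.commute flip: real_sqrt_mult)
  then have m2: "m \<le> 2" by (simp add: m_eq \<sigma>_def)
  define v where "v = - (2 * sqrt s / m) *\<^sub>R grad f x"
  have "\<sigma> * (\<sigma> * norm (grad f x)) \<le> \<sigma> * (\<sigma> * (L * E))"
    using \<sigma> grad_le[of x] by (intro mult_left_mono) (auto simp: E_def)
  also have "\<dots> = (s * L) * E" by (simp add: s power2_eq_square)
  also have "\<dots> \<le> E" using mult_right_mono[OF sL1, of E] E by simp
  finally have g: "\<sigma> * (\<sigma> * norm (grad f x)) \<le> E" .
  have v: "\<sigma> * norm v \<le> 2 * E"
  proof -
    have "\<sigma> * norm v = 2 * (\<sigma> * (\<sigma> * norm (grad f x))) / m"
      using \<sigma> m_pos by (simp add: v_def flip: \<sigma>_def)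
    also have "\<dots> \<le> 2 * E / m"
      using g m_pos by (intro divide_right_mono) auto
    also have "\<dots> \<le> 2 * E"
      using m_gt_1 E by (simp add: field_simps)
    finally show ?thesis .
  qed
  have "\<sigma> * norm (v + (2 * sqrt \<mu>) *\<^sub>R (x - xs)) \<le> \<sigma> * (norm v + 2 * sqrt \<mu> * E)"
    using norm_triangle_ineq[of v "(2 * sqrt \<mu>) *\<^sub>R (x - xs)"] \<sigma> mu_pos
    by (intro mult_left_mono) (auto simp: E_def)
  \<comment> \<open>The sum 2 E + 2 sqrt mu sqrt s E is exactly 2 m E.\<close>
  also have "\<dots> \<le> 2 * m * E"
    using v by (simp add: m_eq \<sigma>_def algebra_simps)
  finally have w: "\<sigma> * norm (v + (2 * sqrt \<mu>) *\<^sub>R (x - xs)) \<le> 2 * m * E" .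
  have v2: "s * (norm v)\<^sup>2 \<le> (2 * E)\<^sup>2"
    using power_mono[OF v, of 2] \<sigma> by (simp add: power_mult_distrib s)
  have w2: "s * (norm (v + (2 * sqrt \<mu>) *\<^sub>R (x - xs)))\<^sup>2 \<le> (2 * m * E)\<^sup>2"
    using power_mono[OF w, of 2] \<sigma> by (simp add: power_mult_distrib s)
  have "s * (f x - f xs) \<le> s * (L / 2 * E\<^sup>2)"
    using s_pos f_gap_le[of x] by (intro mult_left_mono) (auto simp: E_def)
  also have "\<dots> \<le> 1 / 2 * E\<^sup>2"
    using mult_right_mono[OF sL1, of "E\<^sup>2 / 2"] by simp
  finally have "m * (s * (f x - f xs)) \<le> m * (1 / 2 * E\<^sup>2)"
    using m_pos by (intro mult_left_mono) auto
  then have "s * V (x, v) \<le> m * (1 / 2 * E\<^sup>2) + E\<^sup>2 + m\<^sup>2 * E\<^sup>2"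
    using v2 w2 by (simp add: V_hb_def power_mult_distrib algebra_simps)
  \<comment> \<open>With 1 <= m <= 2 the three terms are at most 1/2, 1 and 2 times m E^2, which sum
    to 7/2.\<close>
  also have "\<dots> \<le> m * (1 / 2 * E\<^sup>2) + m * E\<^sup>2 + (2 * m) * E\<^sup>2"
    using m_gt_1 m2 by (intro add_mono mult_right_mono) (use mult_right_mono[of 1 m "E\<^sup>2"] in \<open>auto simp: power2_eq_square\<close>)
  finally have "s * V (x, v) \<le> s * (m * (7 * E\<^sup>2 / (2 * s)))"
    using s_pos by simp
  then show ?thesis
    using s_pos unfolding v_def E_def by (simp only: mult_le_cancel_left_pos)
qed

text \<open>V dominates m times the gap, and the same factor m in \<open>V_initial\<close> cancels
  it.\<close>

lemma f_gap_decay: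
  assumes "0 \<le> a" "a \<le> a1_star \<mu> L s" "s \<le> 1 / L"
    and traj: "trajectory (X a) (\<lambda>t. (x t, v t))"
    and v0: "v 0 = - (2 * sqrt s / m) *\<^sub>R grad f (x 0)" and "t \<ge> 0"
  shows "f (x t) - f xs \<le> 7 * (norm (x 0 - xs))\<^sup>2 / (2 * s) * exp (- (sqrt \<mu> / 4) * t)"
proof -
  have "m * (f (x t) - f xs) \<le> V (x t, v t)"
    by (simp add: V_hb_def)
  also have "\<dots> \<le> V (x 0, v 0) * exp (- (sqrt \<mu> / 4) * t)"
    using V_decay[OF assms(1,2) traj assms(6)] .
  also have "\<dots> \<le> m * (7 * (norm (x 0 - xs))\<^sup>2 / (2 * s)) * exp (- (sqrt \<mu> / 4) * t)"
    unfolding v0 using assms(3) by (intro mult_right_mono V_initial) auto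
  finally show ?thesis
    using m_pos by (simp only: mult.assoc mult_le_cancel_left_pos)
qed

end

theorem mainTheorem1:
  fixes f :: "real ^ 'n \<Rightarrow> real" and xs :: "real ^ 'n" and \<mu> L s :: real
  assumes "\<mu> > 0" and "L > 0" and "s > 0"
    and "\<And>x. f differentiable (at x)"
    and "continuous_on UNIV (grad f)"
    and "strongly_convex \<mu> f"
    and "L-lipschitz_on UNIV (grad f)"
    and "\<And>y. y \<noteq> xs \<Longrightarrow> f xs < f y"
  shows "\<beta>1 \<mu> s > 0 \<and> \<beta>2 \<mu> L s > 0 \<and> \<beta>3 \<mu> > 0 \<and> \<beta>4 \<mu> L s > 0 \<and>
    (\<forall>a. 0 \<le> a \<and> a \<le> a1_star \<mu> L s \<longrightarrow>
      (\<forall>p. grad (V_hb \<mu> s f xs) p \<bullet> X_hb \<mu> s f a p \<le> - (sqrt \<mu> / 4) * V_hb \<mu> s f xs p) \<and>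
      globally_asymptotically_stable (X_hb \<mu> s f a) (xs, 0) \<and>
      (s \<le> 1 / L \<longrightarrow>
        (\<forall>x v. trajectory (X_hb \<mu> s f a) (\<lambda>t. (x t, v t)) \<longrightarrow>
          v 0 = - (2 * sqrt s / (1 + sqrt (\<mu> * s))) *\<^sub>R grad f (x 0) \<longrightarrow>
          (\<forall>t\<ge>0. f (x t) - f xs
            \<le> 7 * (norm (x 0 - xs))\<^sup>2 / (2 * s) * exp (- (sqrt \<mu> / 4) * t)))))"
proof -
  interpret heavy_ball f xs \<mu> L s
    using assms by unfold_locales (auto, metis less_le_not_le linear)
  show ?thesis
  proof (intro conjI allI impI)
    fix a t :: real and x v
    assume "0 \<le> a \<and> a \<le> a1_star \<mu> L s" "s \<le> 1 / L"
      and "trajectory (X_hb \<mu> s f a) (\<lambda>t. (x t, v t))"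
      and "v 0 = - (2 * sqrt s / (1 + sqrt (\<mu> * s))) *\<^sub>R grad f (x 0)" and "0 \<le> t"
    then show "f (x t) - f xs \<le> 7 * (norm (x 0 - xs))\<^sup>2 / (2 * s) * exp (- (sqrt \<mu> / 4) * t)"
      by (intro f_gap_decay[where a = a and v = v]) (auto simp: sqrt_mu_s_def)
  qed (use \<beta>_pos derivative_V_le asymptotic_stability in auto)
qed

end
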